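(* Let $a<b$ be real numbers, $1<p<\infty$ and $r\in(0,1]$. Let $f,u:[a,b]\to\mathbb{R}$ be such that $f\in L^p[a,b]$, $u$ is Lipschitz on $[a,b]$ with constant $L>0$, and $f$ is $r$-$H$-Hölder continuous on $[a,b]$. Then for all $a\le t_0\le x\le t_1\le b$, $$\left|\mathcal{R}^{[a,b]}(f,u;t_0,x,t_1)\right|\le HL\left[(x-a)^{1-\frac1p}\left(\frac{(t_0-a)^{rp+1}+(x-t_0)^{rp+1}}{rp+1}\right)^{\frac1p}+(b-x)^{1-\frac1p}\left(\frac{(t_1-x)^{rp+1}+(b-t_1)^{rp+1}}{rp+1}\right)^{\frac1p}\right].$$
   Context: A function $f:[a,b]\to\mathbb{R}$ is $r$-$H$-Hölder continuous ($H>0$) if $|f(s)-f(t)|\le H|s-t|^r$ for all $s,t\in[a,b]$. For $a\le t_0\le x\le t_1\le b$, the remainder is $$\mathcal{R}^{[a,b]}(f,u;t_0,x,t_1):=\int_a^b f(s)\,du(s)-[u(x)-u(a)]f(t_0)-[u(b)-u(x)]f(t_1),$$ where $\int_a^b f\,du$ is the Riemann–Stieltjes integral. *)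

theory Defs
  imports "HOL-Analysis.Analysis"
begin

text \<open>Membership of a real function in \<open>L\<^sup>p[a,b]\<close>; only the values on \<open>[a,b]\<close> matter.\<close>

definition Lp_on :: "real \<Rightarrow> real \<Rightarrow> real \<Rightarrow> (real \<Rightarrow> real) \<Rightarrow> bool" where
  "Lp_on p a b f \<longleftrightarrow>
     f \<in> borel_measurable (lebesgue_on {a..b}) \<and>
     integrable (lebesgue_on {a..b}) (\<lambda>s. \<bar>f s\<bar> powr p)"

definition holder_on :: "real \<Rightarrow> real \<Rightarrow> real set \<Rightarrow> (real \<Rightarrow> real) \<Rightarrow> bool" where
  "holder_on r H S f \<longleftrightarrow>
     H > 0 \<and> (\<forall>s\<in>S. \<forall>t\<in>S. \<bar>f s - f t\<bar> \<le> H * \<bar>s - t\<bar> powr r)"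

text \<open>The Riemann--Stieltjes integral of \<open>f\<close> against \<open>u\<close> is the limit of the sums of
  \<open>f(s) (u(d) - u(c))\<close>, taken over the tagged subintervals \<open>(s, [c,d])\<close> of a partition,
  as the mesh tends to zero.  The constant bound on \<open>Sup K - Inf K\<close> makes this a Riemann-type
  rather than a gauge integral.  The library's divisions may contain one-point intervals;
  these contribute nothing to the sum.\<close>

definition rs_sum ::
    "(real \<Rightarrow> real) \<Rightarrow> (real \<Rightarrow> real) \<Rightarrow> (real \<times> real set) set \<Rightarrow> real" where
  "rs_sum f u D = (\<Sum>(s, K)\<in>D. f s * (u (Sup K) - u (Inf K)))"

definition has_rs_integral ::
    "real \<Rightarrow> real \<Rightarrow> (real \<Rightarrow> real) \<Rightarrow> (real \<Rightarrow> real) \<Rightarrow> real \<Rightarrow> bool" where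
  "has_rs_integral a b f u I \<longleftrightarrow>
     (\<forall>\<epsilon>>0. \<exists>\<delta>>0. \<forall>D. D tagged_division_of {a..b} \<and> (\<forall>(s, K)\<in>D. Sup K - Inf K < \<delta>)
        \<longrightarrow> \<bar>rs_sum f u D - I\<bar> < \<epsilon>)"

definition rs_integrable :: "real \<Rightarrow> real \<Rightarrow> (real \<Rightarrow> real) \<Rightarrow> (real \<Rightarrow> real) \<Rightarrow> bool" where
  "rs_integrable a b f u \<longleftrightarrow> (\<exists>I. has_rs_integral a b f u I)"

definition rs_integral :: "real \<Rightarrow> real \<Rightarrow> (real \<Rightarrow> real) \<Rightarrow> (real \<Rightarrow> real) \<Rightarrow> real" where
  "rs_integral a b f u = (THE I. has_rs_integral a b f u I)"

definition remainder ::
    "real \<Rightarrow> real \<Rightarrow> (real \<Rightarrow> real) \<Rightarrow> (real \<Rightarrow> real) \<Rightarrow> real \<Rightarrow> real \<Rightarrow> real \<Rightarrow> real" where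
  "remainder a b f u t0 x t1 =
     rs_integral a b f u - (u x - u a) * f t0 - (u b - u x) * f t1"

end

theory Submission imports Defs begin

text \<open>The reparametrisation \<open>v = u + 2 L x\<close> is increasing and bi-Lipschitz, so pulling \<open>f\<close> back
  along \<open>v\<close> and integrating yields a function \<open>G\<close> on \<open>[a,b]\<close> with
  \<open>\<bar>G d - G c - f s (u d - u c)\<bar> \<le> C (d - c)\<^bsup>1+r\<^esup>\<close> whenever \<open>c \<le> s \<le> d\<close>.
  Summing over a partition shows that \<open>G b - G a\<close> is the Riemann--Stieltjes integral.
  For the error bound, \<open>G - f(t0) u\<close> grows no faster than a primitive of \<open>H L \<bar>s - t0\<bar>\<^sup>r\<close> up to
  increments of order \<open>1 + r\<close>, which vanish under subdivision; Hoelder's inequality for the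
  resulting integral is the integrated form of Young's inequality against its mean value.\<close>

lemma powr_mult_self: "(x::real) \<ge> 0 \<Longrightarrow> x powr s * x = x powr (s + 1)"
  by (cases "x = 0") (auto simp: powr_add)

section \<open>Tagged divisions, uniqueness of the integral and a criterion for its value\<close>

lemma Sup_Inf_tagged_division:
  fixes a b :: real
  assumes "D tagged_division_of {a..b}" "(s, K) \<in> D"
  obtains "K = {Inf K..Sup K}" "Inf K \<le> s" "s \<le> Sup K" "a \<le> Inf K" "Sup K \<le> b"
proof -
  obtain c d where K: "K = {c..d}"
    using tagged_division_ofD(4)[OF assms] by auto
  have "s \<in> K" "K \<subseteq> {a..b}"
    using tagged_division_ofD(2,3)[OF assms] by auto
  then have "c \<le> s" "s \<le> d" "a \<le> c" "d \<le> b"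
    unfolding K by auto
  moreover from this have "Inf K = c" "Sup K = d"
    unfolding K by auto
  ultimately show thesis
    using K by (intro that) simp_all
qed

text \<open>Justifies the definite description in \<open>rs_integral\<close>. Two distinct values
  would both be closer than half their distance to the sum over one division of small mesh.\<close>

lemma rs_integral_unique:
  assumes "has_rs_integral a b f u I" "has_rs_integral a b f u J"
  shows "I = J"
proof (rule ccontr)
  assume "I \<noteq> J"
  define e where "e = \<bar>I - J\<bar> / 2"
  have "e > 0"
    using \<open>I \<noteq> J\<close> by (simp add: e_def)
  obtain d1 where d1: "d1 > 0" "\<forall>D. D tagged_division_of {a..b} \<and>
      (\<forall>(s, K)\<in>D. Sup K - Inf K < d1) \<longrightarrow> \<bar>rs_sum f u D - I\<bar> < e"
    using assms(1)[unfolded has_rs_integral_def, rule_format, OF \<open>e > 0\<close>] by (elim exE conjE)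
  obtain d2 where d2: "d2 > 0" "\<forall>D. D tagged_division_of {a..b} \<and>
      (\<forall>(s, K)\<in>D. Sup K - Inf K < d2) \<longrightarrow> \<bar>rs_sum f u D - J\<bar> < e"
    using assms(2)[unfolded has_rs_integral_def, rule_format, OF \<open>e > 0\<close>] by (elim exE conjE)
  define d where "d = min d1 d2"
  have "d > 0"
    using d1(1) d2(1) by (simp add: d_def)
  \<comment> \<open>Cousin's lemma for a gauge of constant radius supplies the division: each
    interval lies in the ball of radius \<open>d / 2\<close> about its tag, so it is shorter than
    \<open>d\<close>.\<close>
  then have "gauge (\<lambda>x::real. ball x (d / 2))"
    by (intro gauge_ball) auto
  then obtain D where D: "D tagged_division_of {a..b}" "(\<lambda>x. ball x (d / 2)) fine D"
    by (rule fine_division_exists_real)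
  have "Sup K - Inf K < d" if sK: "(s, K) \<in> D" for s K
  proof (rule Sup_Inf_tagged_division[OF D(1) sK])
    assume K: "K = {Inf K..Sup K}" "Inf K \<le> s" "s \<le> Sup K"
    have "Sup K \<in> K" "Inf K \<in> K"
      using K by (metis atLeastAtMost_iff order_trans order_refl)+
    moreover have "K \<subseteq> ball s (d / 2)"
      using D(2) sK by (auto simp: fine_def)
    ultimately have "dist s (Sup K) < d / 2" "dist s (Inf K) < d / 2"
      by auto
    then show ?thesis
      unfolding dist_real_def by linarith
  qed
  then have "\<forall>(s, K)\<in>D. Sup K - Inf K < d1" "\<forall>(s, K)\<in>D. Sup K - Inf K < d2"
    by (fastforce simp: d_def)+
  with d1(2) d2(2) D(1) have "\<bar>rs_sum f u D - I\<bar> < e" "\<bar>rs_sum f u D - J\<bar> < e"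
    by blast+
  moreover have "\<bar>I - J\<bar> \<le> \<bar>rs_sum f u D - I\<bar> + \<bar>rs_sum f u D - J\<bar>"
    using abs_triangle_ineq4[of "rs_sum f u D - J" "rs_sum f u D - I"] by simp
  ultimately show False
    by (simp add: e_def)
qed

text \<open>Over any tagged division the increments of \<open>G\<close> telescope to
  \<open>G b - G a\<close>, so the error of the sum is at most the sum of the local errors. With all
  lengths below d this is at most C (b - a) d^r, which vanishes with the mesh.\<close>

lemma has_rs_integralI_increments:
  fixes f u G :: "real \<Rightarrow> real"
  assumes "a \<le> b" "0 < r" "0 \<le> C"
    and G: "\<And>c s d. \<lbrakk>a \<le> c; c \<le> s; s \<le> d; d \<le> b\<rbrakk> \<Longrightarrow>
      \<bar>G d - G c - f s * (u d - u c)\<bar> \<le> C * (d - c) powr r * (d - c)"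
  shows "has_rs_integral a b f u (G b - G a)"
  unfolding has_rs_integral_def
proof (intro allI impI)
  fix e :: real
  assume "e > 0"
  \<comment> \<open>With \<open>d powr r = e / M\<close> the total error is at most
    \<open>C * (e / M) * (b - a)\<close>. The summand 1 keeps \<open>M\<close> positive and makes
    this bound strictly less than \<open>e\<close>.\<close>
  define M where "M = C * (b - a) + 1"
  have "M > 0"
    using assms by (simp add: M_def add_nonneg_pos)
  define d where "d = (e / M) powr (1 / r)"
  have "d > 0"
    using \<open>e > 0\<close> \<open>M > 0\<close> by (simp add: d_def)
  have dr: "d powr r = e / M"
    using \<open>e > 0\<close> \<open>M > 0\<close> \<open>0 < r\<close> by (simp add: d_def powr_powr)
  have "\<bar>rs_sum f u D - (G b - G a)\<bar> < e"
    if D: "D tagged_division_of {a..b}" and mesh: "\<forall>(s, K)\<in>D. Sup K - Inf K < d" for D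
  proof -
    have "\<bar>rs_sum f u D - (G b - G a)\<bar> =
        \<bar>\<Sum>(s, K)\<in>D. f s * (u (Sup K) - u (Inf K)) - (G (Sup K) - G (Inf K))\<bar>"
      unfolding rs_sum_def additive_tagged_division_1[OF \<open>a \<le> b\<close> D, of G, symmetric]
      by (simp add: sum_subtractf[symmetric] case_prod_unfold)
    also have "\<dots> \<le> (\<Sum>(s, K)\<in>D. C * (e / M) * (Sup K - Inf K))"
    proof (rule order_trans[OF sum_abs], rule sum_mono, clarify)
      fix s K
      assume sK: "(s, K) \<in> D"
      then have lt: "Sup K - Inf K < d"
        using mesh by auto
      show "\<bar>f s * (u (Sup K) - u (Inf K)) - (G (Sup K) - G (Inf K))\<bar> \<le> C * (e / M) * (Sup K - Inf K)"
      proof (rule Sup_Inf_tagged_division[OF D sK])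
        assume K: "Inf K \<le> s" "s \<le> Sup K" "a \<le> Inf K" "Sup K \<le> b"
        have "(Sup K - Inf K) powr r \<le> e / M"
          unfolding dr[symmetric] using K lt \<open>0 < r\<close> by (intro powr_mono2) auto
        then have "C * (Sup K - Inf K) powr r * (Sup K - Inf K) \<le> C * (e / M) * (Sup K - Inf K)"
          using K \<open>0 \<le> C\<close> by (intro mult_right_mono mult_left_mono) auto
        with G[OF K(3,1,2,4)] show ?thesis
          by (subst abs_minus_commute) (rule order_trans)
      qed
    qed
    also have "\<dots> = C * (e / M) * (b - a)"
      using additive_tagged_division_1[OF \<open>a \<le> b\<close> D, of "\<lambda>x. x"]
      by (simp only: case_prod_unfold sum_distrib_left[symmetric])
    also have "\<dots> < e"
      using \<open>M > 0\<close> \<open>e > 0\<close> by (simp add: field_simps) (simp add: M_def algebra_simps)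
    finally show ?thesis .
  qed
  then show "\<exists>d>0. \<forall>D. D tagged_division_of {a..b} \<and> (\<forall>(s, K)\<in>D. Sup K - Inf K < d) \<longrightarrow>
      \<bar>rs_sum f u D - (G b - G a)\<bar> < e"
    using \<open>d > 0\<close> by blast
qed

section \<open>Approximate primitives for increasing and for Lipschitz integrators\<close>

lemma holder_on_imp_continuous_on:
  assumes "holder_on r H S f" "0 < r"
  shows "continuous_on S f"
  unfolding continuous_on_def
proof
  fix x
  assume x: "x \<in> S"
  have "((\<lambda>y. H * \<bar>y - x\<bar> powr r) \<longlongrightarrow> H * \<bar>x - x\<bar> powr r) (at x within S)"
    using \<open>0 < r\<close> by (intro tendsto_intros tendsto_powr') auto
  then have "((\<lambda>y. H * \<bar>y - x\<bar> powr r) \<longlongrightarrow> 0) (at x within S)"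
    by simp
  moreover have "\<forall>\<^sub>F y in at x within S. norm (f y - f x) \<le> H * \<bar>y - x\<bar> powr r"
    using assms(1) x by (auto simp: eventually_at_filter holder_on_def)
  ultimately have "((\<lambda>y. f y - f x) \<longlongrightarrow> 0) (at x within S)"
    by (rule Lim_null_comparison[rotated])
  then show "(f \<longlongrightarrow> f x) (at x within S)"
    by (rule Lim_null[THEN iffD2])
qed

text \<open>The substitution \<open>y = v x\<close> turns integration against \<open>v\<close> into
  ordinary integration of \<open>f\<close> composed with the inverse \<open>w\<close>. On
  \<open>{v c..v d}\<close> the inverse takes values in \<open>{c..d}\<close>, so the integrand
  stays within H (d - c)^r of \<open>f s\<close>.\<close>

lemma increasing_integrator_increments:
  fixes f v :: "real \<Rightarrow> real"
  assumes "0 < r" and f: "holder_on r H {a..b} f"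
    and v: "continuous_on {a..b} v" "strict_mono_on {a..b} v"
  obtains G where "\<And>c s d. \<lbrakk>a \<le> c; c \<le> s; s \<le> d; d \<le> b\<rbrakk> \<Longrightarrow>
      \<bar>G d - G c - f s * (v d - v c)\<bar> \<le> H * (d - c) powr r * (v d - v c)"
proof -
  define w where "w = inv_into {a..b} v"
  have inj: "inj_on v {a..b}"
    using v(2) by (rule strict_mono_on_imp_inj_on)
  have wv: "w (v x) = x" if "x \<in> {a..b}" for x
    using inj that by (simp add: w_def)
  have mono: "v x \<le> v y" if "a \<le> x" "x \<le> y" "y \<le> b" for x y
    using v(2) that by (simp add: strict_mono_on_leD)
  have surj: "\<exists>x. c \<le> x \<and> x \<le> d \<and> v x = y"
    if "a \<le> c" "c \<le> d" "d \<le> b" "v c \<le> y" "y \<le> v d" for c d y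
    using that by (intro IVT' continuous_on_subset[OF v(1)]) auto
  \<comment> \<open>Compactness of \<open>{a..b}\<close> makes the inverse of a continuous injection
    continuous.\<close>
  have "continuous_on (v ` {a..b}) w"
    using v(1) wv by (intro continuous_on_inv) auto
  moreover have "w ` v ` {a..b} \<subseteq> {a..b}"
    using wv by auto
  ultimately have cont: "continuous_on (v ` {a..b}) (\<lambda>y. f (w y))"
    using holder_on_imp_continuous_on[OF f \<open>0 < r\<close>]
    by (metis continuous_on_compose2)
  have int: "(\<lambda>y. f (w y)) integrable_on {v c..v d}" if "a \<le> c" "c \<le> d" "d \<le> b" for c d
  proof (rule integrable_continuous_interval, rule continuous_on_subset[OF cont], rule subsetI)
    fix y
    assume "y \<in> {v c..v d}"
    then show "y \<in> v ` {a..b}"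
      using surj[OF that, of y] that by force
  qed
  define G where "G t = integral {v a..v t} (\<lambda>y. f (w y))" for t
  have "\<bar>G d - G c - f s * (v d - v c)\<bar> \<le> H * (d - c) powr r * (v d - v c)"
    if A: "a \<le> c" "c \<le> s" "s \<le> d" "d \<le> b" for c s d
  proof -
    have le: "v a \<le> v c" "v c \<le> v d"
      using mono A by auto
    have i: "(\<lambda>y. f (w y)) integrable_on {v c..v d}" "(\<lambda>y. f (w y)) integrable_on {v a..v d}"
      using int A by auto
    have "G d - G c = integral {v c..v d} (\<lambda>y. f (w y))"
      using Henstock_Kurzweil_Integration.integral_combine[OF le i(2)] by (simp add: G_def)
    then have "((\<lambda>y. f (w y) - f s) has_integral G d - G c - f s * (v d - v c)) {v c..v d}"
      using has_integral_diff[OF integrable_integral[OF i(1)] has_integral_const_real[of "f s" "v c" "v d"]] le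
      by (simp add: mult.commute)
    moreover have "norm (f (w y) - f s) \<le> H * (d - c) powr r" if y: "y \<in> cbox (v c) (v d)" for y
    proof -
      obtain x where x: "c \<le> x" "x \<le> d" "v x = y"
        using surj[of c d y] y A by auto
      have "\<bar>f x - f s\<bar> \<le> H * \<bar>x - s\<bar> powr r" "H > 0"
        using f x A by (auto simp: holder_on_def)
      moreover have "\<bar>x - s\<bar> powr r \<le> (d - c) powr r"
        using x A \<open>0 < r\<close> by (intro powr_mono2) auto
      ultimately have "\<bar>f x - f s\<bar> \<le> H * (d - c) powr r"
        by (meson mult_left_mono order_trans less_imp_le)
      then show ?thesis
        using wv[of x] x A by simp
    qed
    moreover have "0 \<le> H * (d - c) powr r"
      using f by (simp add: holder_on_def)
    ultimately show ?thesis
      using has_integral_bound[of "H * (d - c) powr r" "\<lambda>y. f (w y) - f s" _ "v c" "v d"] le by simp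
  qed
  with that show thesis .
qed

text \<open>\<open>u\<close> is the difference of the increasing functions u + 2 L x and 2 L x.
  Subtracting their approximate primitives gives one for \<open>u\<close>.\<close>

lemma lipschitz_integrator_increments:
  fixes f u :: "real \<Rightarrow> real"
  assumes "0 < r" "0 < L" and f: "holder_on r H {a..b} f" and u: "L-lipschitz_on {a..b} u"
  obtains G where "\<And>c s d. \<lbrakk>a \<le> c; c \<le> s; s \<le> d; d \<le> b\<rbrakk> \<Longrightarrow>
      \<bar>G d - G c - f s * (u d - u c)\<bar> \<le> 5 * H * L * (d - c) powr r * (d - c)"
proof -
  have u_le: "\<bar>u d - u c\<bar> \<le> L * (d - c)" if "a \<le> c" "c \<le> d" "d \<le> b" for c d
    using lipschitz_onD[OF u, of d c] that by (simp add: dist_real_def)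
  \<comment> \<open>The slopes of \<open>u\<close> are at least \<open>- L\<close>, so those of
    \<open>v\<close> are at least \<open>L\<close>; adding \<open>L * x\<close> alone would not
    ensure strict monotonicity.\<close>
  define v where "v x = u x + 2 * L * x" for x
  have "v x < v y" if "a \<le> x" "x < y" "y \<le> b" for x y
  proof -
    have "L * (y - x) > 0"
      using that \<open>0 < L\<close> by simp
    with u_le[of x y] that show ?thesis
      by (auto simp: v_def algebra_simps)
  qed
  then have "strict_mono_on {a..b} v"
    by (auto intro!: strict_mono_onI)
  moreover have "continuous_on {a..b} v"
    unfolding v_def using u by (intro continuous_intros lipschitz_on_continuous_on)
  ultimately obtain G1 where G1: "\<And>c s d. \<lbrakk>a \<le> c; c \<le> s; s \<le> d; d \<le> b\<rbrakk> \<Longrightarrow>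
      \<bar>G1 d - G1 c - f s * (v d - v c)\<bar> \<le> H * (d - c) powr r * (v d - v c)"
    using increasing_integrator_increments[OF \<open>0 < r\<close> f] by metis
  have "strict_mono_on {a..b} (\<lambda>x. 2 * L * x)"
    using \<open>0 < L\<close> by (auto intro!: strict_mono_onI)
  moreover have "continuous_on {a..b} (\<lambda>x. 2 * L * x)"
    by (intro continuous_intros)
  ultimately obtain G2 where G2: "\<And>c s d. \<lbrakk>a \<le> c; c \<le> s; s \<le> d; d \<le> b\<rbrakk> \<Longrightarrow>
      \<bar>G2 d - G2 c - f s * (2 * L * d - 2 * L * c)\<bar> \<le> H * (d - c) powr r * (2 * L * d - 2 * L * c)"
    using increasing_integrator_increments[OF \<open>0 < r\<close> f] by metis
  have "\<bar>(G1 d - G2 d) - (G1 c - G2 c) - f s * (u d - u c)\<bar> \<le> 5 * H * L * (d - c) powr r * (d - c)"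
    if A: "a \<le> c" "c \<le> s" "s \<le> d" "d \<le> b" for c s d
  proof -
    define w where "w = H * (d - c) powr r"
    have "w \<ge> 0"
      using f by (simp add: w_def holder_on_def)
    \<comment> \<open>The constant 5 is 3 + 2: \<open>v\<close> grows by at most
      \<open>3 * L * (d - c)\<close>, the linear integrator by
      \<open>2 * L * (d - c)\<close>.\<close>
    have "v d - v c + (2 * L * d - 2 * L * c) \<le> 5 * L * (d - c)"
      using u_le[of c d] A by (simp add: v_def algebra_simps)
    then have "w * (v d - v c) + w * (2 * L * d - 2 * L * c) \<le> w * (5 * L * (d - c))"
      using mult_left_mono[OF _ \<open>w \<ge> 0\<close>] by (simp add: distrib_left[symmetric])
    moreover have "\<bar>(G1 d - G1 c - f s * (v d - v c)) - (G2 d - G2 c - f s * (2 * L * d - 2 * L * c))\<bar> \<le>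
        w * (v d - v c) + w * (2 * L * d - 2 * L * c)"
      using G1[OF A] G2[OF A] unfolding w_def by (intro order_trans[OF abs_triangle_ineq4 add_mono])
    moreover have "(G1 d - G2 d) - (G1 c - G2 c) - f s * (u d - u c) =
        (G1 d - G1 c - f s * (v d - v c)) - (G2 d - G2 c - f s * (2 * L * d - 2 * L * c))"
      by (simp add: v_def algebra_simps)
    ultimately have "\<bar>(G1 d - G2 d) - (G1 c - G2 c) - f s * (u d - u c)\<bar> \<le> w * (5 * L * (d - c))"
      by linarith
    then show ?thesis
      by (simp only: w_def mult_ac)
  qed
  then show thesis
    by (rule that)
qed

section \<open>Increments dominated by the integral of \<bar>s - t\<bar>^r\<close>

text \<open>Cut the interval into \<open>Suc n\<close> equal pieces of length h. The increments add
  up to at most C (b - a) h^r, and h tends to zero.\<close>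

lemma superlinear_increments_imp_le:
  fixes g :: "real \<Rightarrow> real"
  assumes "a \<le> b" "0 < r"
    and g: "\<And>c d. \<lbrakk>a \<le> c; c \<le> d; d \<le> b\<rbrakk> \<Longrightarrow> g d - g c \<le> C * (d - c) powr r * (d - c)"
  shows "g b \<le> g a"
proof -
  have bound: "g b - g a \<le> C * (b - a) * ((b - a) / real (Suc n)) powr r" for n
  proof -
    define h where "h = (b - a) / real (Suc n)"
    have h: "h \<ge> 0" "real (Suc n) * h = b - a"
      using \<open>a \<le> b\<close> by (simp_all add: h_def)
    have "g b - g a = (\<Sum>i<Suc n. g (a + real (Suc i) * h) - g (a + real i * h))"
      by (subst sum_lessThan_telescope) (use h in simp)
    also have "\<dots> \<le> (\<Sum>i<Suc n. C * h powr r * h)"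
    proof (rule sum_mono)
      fix i
      assume "i \<in> {..<Suc n}"
      then have "real (Suc i) * h \<le> real (Suc n) * h"
        using h by (intro mult_right_mono) auto
      then have "a + real (Suc i) * h \<le> b"
        unfolding h(2) by simp
      with g[of "a + real i * h" "a + real (Suc i) * h"] h
      show "g (a + real (Suc i) * h) - g (a + real i * h) \<le> C * h powr r * h"
        by (simp add: algebra_simps)
    qed
    also have "\<dots> = C * (real (Suc n) * h) * h powr r"
      by simp
    finally show ?thesis
      unfolding h(2) by (simp add: h_def)
  qed
  have "(\<lambda>n. (b - a) / real (Suc n)) \<longlonglongrightarrow> 0"
    using tendsto_mult[OF tendsto_const[of "b - a"] LIMSEQ_inverse_real_of_nat]
    by (simp add: divide_inverse)
  then have "(\<lambda>n. ((b - a) / real (Suc n)) powr r) \<longlonglongrightarrow> 0 powr r"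
    using assms by (intro tendsto_powr') auto
  then have "(\<lambda>n. C * (b - a) * ((b - a) / real (Suc n)) powr r) \<longlonglongrightarrow> C * (b - a) * 0"
    by (intro tendsto_mult_left) simp
  then have "g b - g a \<le> C * (b - a) * 0"
    using bound by (intro LIMSEQ_le_const) auto
  then show ?thesis
    by simp
qed

text \<open>The right-hand side is the integral of \<bar>x - t\<bar>^r over [c,d], and
  \<open>s\<close> is its mean value point. Since \<open>t\<close> is not interior,
  \<open>x - t\<close> has one sign \<open>\<sigma>\<close> there, and a single power function is a
  primitive up to that sign.\<close>

lemma powr_integral_mean_value:
  fixes c d t r :: real
  assumes "0 < r" "c \<le> d" "d \<le> t \<or> t \<le> c"
  obtains s where "c \<le> s" "s \<le> d"
    "\<bar>s - t\<bar> powr r * (d - c) = \<bar>\<bar>d - t\<bar> powr (r + 1) - \<bar>c - t\<bar> powr (r + 1)\<bar> / (r + 1)"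
proof (cases "c = d")
  case False
  then have "c < d"
    using assms by simp
  define \<sigma> :: real where "\<sigma> = (if d \<le> t then - 1 else 1)"
  have \<sigma>: "\<bar>x - t\<bar> = \<sigma> * (x - t)" "0 \<le> \<sigma> * (x - t)" if "c \<le> x" "x \<le> d" for x
    using assms that \<open>c < d\<close> by (auto simp: \<sigma>_def)
  have pos: "0 < \<sigma> * (x - t)" if "c < x" "x < d" for x
    using assms that by (auto simp: \<sigma>_def)
  have \<sigma>2: "\<sigma> * \<sigma> = 1" "\<bar>\<sigma>\<bar> = 1"
    by (auto simp: \<sigma>_def)
  define F where "F x = (\<sigma> * (x - t)) powr (r + 1) / (r + 1)" for x
  have "continuous_on {c..d} F"
    unfolding F_def using \<sigma> \<open>0 < r\<close> by (intro continuous_intros continuous_on_powr') auto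
  \<comment> \<open>The base of the power vanishes at an endpoint equal to \<open>t\<close>, so the
    derivative is taken in the open interval only.\<close>
  moreover have "(F has_real_derivative \<sigma> * (\<sigma> * (x - t)) powr r) (at x)" if "c < x" "x < d" for x
    unfolding F_def using pos[OF that] \<open>0 < r\<close>
    by (auto intro!: derivative_eq_intros)
  ultimately obtain s where s: "c < s" "s < d" "F d - F c = (d - c) * (\<sigma> * (\<sigma> * (s - t)) powr r)"
    using MVT[OF \<open>c < d\<close>, of F] by (metis DERIV_unique real_differentiable_def)
  have "\<bar>F d - F c\<bar> = (d - c) * \<bar>s - t\<bar> powr r"
    using s \<sigma>[of s] \<sigma>2 by (simp add: abs_mult)
  moreover have "\<bar>F d - F c\<bar> = \<bar>\<bar>d - t\<bar> powr (r + 1) - \<bar>c - t\<bar> powr (r + 1)\<bar> / (r + 1)"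
    using \<sigma>[of c] \<sigma>[of d] \<open>c < d\<close> \<open>0 < r\<close> by (simp add: F_def diff_divide_distrib[symmetric])
  ultimately show thesis
    using that[of s] s by (simp add: mult.commute)
qed (use that in auto)

text \<open>The tag \<open>s\<close> may be chosen freely. At the mean value point the first term of
  the bound is exactly the increment of the primitive \<open>P\<close>, and the remaining error of
  order 1 + r disappears under subdivision.\<close>

lemma increment_bound_one_sided:
  fixes g :: "real \<Rightarrow> real"
  assumes "a \<le> b" "0 < r" "b \<le> t \<or> t \<le> a" "0 \<le> M"
    and g: "\<And>c s d. \<lbrakk>a \<le> c; c \<le> s; s \<le> d; d \<le> b\<rbrakk> \<Longrightarrow>
      \<bar>g d - g c\<bar> \<le> M * \<bar>s - t\<bar> powr r * (d - c) + C * (d - c) powr r * (d - c)"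
  shows "\<bar>g b - g a\<bar> \<le> M * (\<bar>\<bar>b - t\<bar> powr (r + 1) - \<bar>a - t\<bar> powr (r + 1)\<bar> / (r + 1))"
proof -
  define \<sigma> :: real where "\<sigma> = (if b \<le> t then - 1 else 1)"
  \<comment> \<open>The sign makes \<open>P\<close> a nondecreasing primitive of M \<bar>x -
    t\<bar>^r on whichever side of \<open>t\<close> the interval lies.\<close>
  define P where "P x = M * (\<sigma> * \<bar>x - t\<bar> powr (r + 1) / (r + 1))" for x
  have P_eq: "P d - P c = M * (\<bar>\<bar>d - t\<bar> powr (r + 1) - \<bar>c - t\<bar> powr (r + 1)\<bar> / (r + 1))"
    if A: "a \<le> c" "c \<le> d" "d \<le> b" for c d
  proof (cases "b \<le> t")
    case True
    then have "\<bar>d - t\<bar> powr (r + 1) \<le> \<bar>c - t\<bar> powr (r + 1)"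
      using A \<open>0 < r\<close> by (intro powr_mono2) auto
    with True show ?thesis
      by (simp add: P_def \<sigma>_def right_diff_distrib diff_divide_distrib)
  next
    case False
    then have "\<bar>c - t\<bar> powr (r + 1) \<le> \<bar>d - t\<bar> powr (r + 1)"
      using A \<open>0 < r\<close> assms(3) by (intro powr_mono2) auto
    with False show ?thesis
      by (simp add: P_def \<sigma>_def right_diff_distrib diff_divide_distrib)
  qed
  have step: "\<bar>g d - g c\<bar> \<le> P d - P c + C * (d - c) powr r * (d - c)"
    if A: "a \<le> c" "c \<le> d" "d \<le> b" for c d
  proof -
    have "d \<le> t \<or> t \<le> c"
      using assms(3) A by auto
    then obtain s where s: "c \<le> s" "s \<le> d"
      "\<bar>s - t\<bar> powr r * (d - c) = \<bar>\<bar>d - t\<bar> powr (r + 1) - \<bar>c - t\<bar> powr (r + 1)\<bar> / (r + 1)"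
      using powr_integral_mean_value[OF \<open>0 < r\<close> \<open>c \<le> d\<close>] by blast
    then show ?thesis
      using g[of c s d] A by (simp add: P_eq[OF A] mult.assoc)
  qed
  \<comment> \<open>Comparing both \<open>g\<close> and \<open>- g\<close> with \<open>P\<close>
    bounds the absolute value.\<close>
  have "(g b - P b) \<le> (g a - P a)"
    by (rule superlinear_increments_imp_le[OF \<open>a \<le> b\<close> \<open>0 < r\<close>, where C = C])
      (use step in \<open>force simp: abs_le_iff\<close>)
  moreover have "(- g b - P b) \<le> (- g a - P a)"
    by (rule superlinear_increments_imp_le[OF \<open>a \<le> b\<close> \<open>0 < r\<close>, where C = C])
      (use step in \<open>force simp: abs_le_iff\<close>)
  ultimately have "\<bar>g b - g a\<bar> \<le> P b - P a"
    by simp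
  then show ?thesis
    using P_eq[of a b] \<open>a \<le> b\<close> by simp
qed

text \<open>Splitting at \<open>t\<close> puts each half on one side of it; the boundary terms at
  \<open>t\<close> itself are zero because \<open>0 powr (r + 1) = 0\<close>.\<close>

lemma increment_bound:
  fixes g :: "real \<Rightarrow> real"
  assumes "a \<le> t" "t \<le> b" "0 < r" "0 \<le> M"
    and g: "\<And>c s d. \<lbrakk>a \<le> c; c \<le> s; s \<le> d; d \<le> b\<rbrakk> \<Longrightarrow>
      \<bar>g d - g c\<bar> \<le> M * \<bar>s - t\<bar> powr r * (d - c) + C * (d - c) powr r * (d - c)"
  shows "\<bar>g b - g a\<bar> \<le> M * (((t - a) powr (r + 1) + (b - t) powr (r + 1)) / (r + 1))"
proof -
  have "\<bar>g t - g a\<bar> \<le> M * (\<bar>\<bar>t - t\<bar> powr (r + 1) - \<bar>a - t\<bar> powr (r + 1)\<bar> / (r + 1))"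
    using assms by (intro increment_bound_one_sided[where C = C] g) auto
  moreover have "\<bar>g b - g t\<bar> \<le> M * (\<bar>\<bar>b - t\<bar> powr (r + 1) - \<bar>t - t\<bar> powr (r + 1)\<bar> / (r + 1))"
    using assms by (intro increment_bound_one_sided[where C = C] g) auto
  ultimately show ?thesis
    using assms by (simp add: add_divide_distrib distrib_left)
qed

section \<open>Hoelder's inequality for the integral of \<bar>s - t\<bar>^r\<close>

text \<open>Convexity of y^p: the graph lies above its tangent at \<open>m\<close>. This is Young's
  inequality with the conjugate exponents p and p / (p - 1).\<close>

lemma Young_tangent:
  fixes p m y :: real
  assumes "1 < p" "0 \<le> m" "0 \<le> y"
  shows "p * m powr (p - 1) * y \<le> y powr p + (p - 1) * m powr p"
proof -
  have "y * m powr (p - 1) \<le> y powr p / p + (m powr (p - 1)) powr (p / (p - 1)) / (p / (p - 1))"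
    using assms by (intro Youngs_inequality) (auto simp: field_simps)
  also have "(m powr (p - 1)) powr (p / (p - 1)) = m powr p"
    using assms by (simp add: powr_powr)
  finally show ?thesis
    using assms by (simp add: field_simps)
qed

text \<open>The tangent inequality at y = x^r, integrated over x from 0 to \<open>A\<close>.\<close>

lemma Young_tangent_integrated:
  fixes p r m A :: real
  assumes "1 < p" "0 < r" "0 \<le> m" "0 \<le> A"
  shows "p * m powr (p - 1) * (A powr (r + 1) / (r + 1)) \<le>
    A powr (r * p + 1) / (r * p + 1) + (p - 1) * m powr p * A"
proof -
  have rp: "0 < r * p + 1"
    using assms by (simp add: add_pos_pos)
  have cont: "continuous_on {0..A} (\<lambda>x. x powr q)" if "0 < q" for q :: real
    using that by (intro continuous_on_powr') auto
  \<comment> \<open>Right side minus left side as a function of the upper limit: it is 0 at 0, and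
    its derivative is the tangent inequality, so monotonicity replaces integration.\<close>
  define g where "g x = x powr (r * p + 1) / (r * p + 1) + (p - 1) * m powr p * x
    - p * m powr (p - 1) * (x powr (r + 1) / (r + 1))" for x
  have "g 0 \<le> g A"
  proof (rule DERIV_nonneg_imp_increasing_open[OF \<open>0 \<le> A\<close>])
    show "continuous_on {0..A} g"
      unfolding g_def using rp assms
      by (intro continuous_on_diff continuous_on_add continuous_on_mult continuous_on_divide
          continuous_on_const continuous_on_id cont) auto
    fix x
    assume x: "0 < x" "x < A"
    have "(g has_real_derivative
        x powr (r * p) + (p - 1) * m powr p - p * m powr (p - 1) * x powr r) (at x)"
      unfolding g_def using x rp assms by (auto intro!: derivative_eq_intros)
    moreover have "p * m powr (p - 1) * x powr r \<le> x powr (r * p) + (p - 1) * m powr p"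
      using Young_tangent[of p m "x powr r"] assms by (simp add: powr_powr)
    ultimately show "\<exists>y. (g has_real_derivative y) (at x) \<and> 0 \<le> y"
      by (meson diff_ge_0_iff_ge)
  qed
  then show ?thesis
    using rp assms by (simp add: g_def)
qed

text \<open>If \<open>t\<close> cuts an interval into lengths \<open>A\<close> and \<open>B\<close>,
  the two fractions are the integrals of \<bar>s - t\<bar>^r and \<bar>s - t\<bar>^(r p). The
  tangent inequality at the mean value \<open>m\<close> gives Jensen's bound m^p (A + B) \<le> J,
  and a p-th root finishes.\<close>

lemma Hoelder_powr_integral:
  fixes p r A B :: real
  assumes "1 < p" "0 < r" "0 \<le> A" "0 \<le> B"
  shows "(A powr (r + 1) + B powr (r + 1)) / (r + 1) \<le>
    (A + B) powr (1 - 1 / p) *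
      ((A powr (r * p + 1) + B powr (r * p + 1)) / (r * p + 1)) powr (1 / p)"
proof (cases "A + B = 0")
  case True
  then show ?thesis
    using assms by (simp add: add_nonneg_eq_0_iff)
next
  case False
  then have S: "A + B > 0"
    using assms by simp
  define I where "I = (A powr (r + 1) + B powr (r + 1)) / (r + 1)"
  define J where "J = (A powr (r * p + 1) + B powr (r * p + 1)) / (r * p + 1)"
  define m where "m = I / (A + B)"
  have m: "m \<ge> 0"
    using assms by (auto simp: I_def m_def)
  have I: "I = m * (A + B)"
    using S by (simp add: m_def)
  have "p * m powr (p - 1) * I \<le> J + (p - 1) * m powr p * (A + B)"
    using Young_tangent_integrated[OF assms(1,2) m \<open>0 \<le> A\<close>]
      Young_tangent_integrated[OF assms(1,2) m \<open>0 \<le> B\<close>]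
    by (simp add: I_def J_def add_divide_distrib distrib_left)
  \<comment> \<open>At the mean value the left side is p times m^p (A + B), of which p - 1 times
    cancel against the right side.\<close>
  moreover have "p * m powr (p - 1) * I = p * (m powr p * (A + B))"
    using powr_mult_self[OF m, of "p - 1"] by (simp add: I mult_ac)
  ultimately have J: "m powr p * (A + B) \<le> J"
    by (simp add: algebra_simps)
  have "I = (A + B) powr (1 - 1 / p) * (m powr p * (A + B)) powr (1 / p)"
    using S m assms by (simp add: I powr_mult powr_powr powr_diff)
  also have "\<dots> \<le> (A + B) powr (1 - 1 / p) * J powr (1 / p)"
    using J S m assms by (intro mult_left_mono powr_mono2) auto
  finally show ?thesis
    by (simp add: I_def J_def)
qed

section \<open>Existence of the integral and the bound on the remainder\<close>

theorem theorem2: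
  fixes a b p r H L :: real and f u :: "real \<Rightarrow> real"
  assumes "a < b" and "1 < p" and "0 < r" and "r \<le> 1"
    and "Lp_on p a b f"
    and "L > 0" and "L-lipschitz_on {a..b} u"
    and "holder_on r H {a..b} f"
  shows "rs_integrable a b f u \<and>
    (\<forall>t0 x t1. a \<le> t0 \<and> t0 \<le> x \<and> x \<le> t1 \<and> t1 \<le> b \<longrightarrow>
      \<bar>remainder a b f u t0 x t1\<bar> \<le>
        H * L *
          ((x - a) powr (1 - 1 / p) *
             (((t0 - a) powr (r * p + 1) + (x - t0) powr (r * p + 1)) / (r * p + 1)) powr (1 / p)
         + (b - x) powr (1 - 1 / p) *
             (((t1 - x) powr (r * p + 1) + (b - t1) powr (r * p + 1)) / (r * p + 1)) powr (1 / p)))"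
proof -
  note f = \<open>holder_on r H {a..b} f\<close> and u = \<open>L-lipschitz_on {a..b} u\<close>
  have "H > 0"
    using f by (simp add: holder_on_def)
  obtain G where G: "\<And>c s d. \<lbrakk>a \<le> c; c \<le> s; s \<le> d; d \<le> b\<rbrakk> \<Longrightarrow>
      \<bar>G d - G c - f s * (u d - u c)\<bar> \<le> 5 * H * L * (d - c) powr r * (d - c)"
    using lipschitz_integrator_increments[OF \<open>0 < r\<close> \<open>L > 0\<close> f u] by blast
  have int: "has_rs_integral a b f u (G b - G a)"
    using assms \<open>H > 0\<close> G by (intro has_rs_integralI_increments[where C = "5 * H * L" and r = r]) auto
  then have int_eq: "rs_integral a b f u = G b - G a"
    unfolding rs_integral_def by (rule the_equality) (use int rs_integral_unique in blast)
  \<comment> \<open>One estimate serves both summands of the bound: the interval from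
    \<open>a\<close> to \<open>x\<close> with node \<open>t0\<close>, and from \<open>x\<close> to
    \<open>b\<close> with node \<open>t1\<close>.\<close>
  have piece: "\<bar>G y - G x - f t * (u y - u x)\<bar> \<le> H * L * ((y - x) powr (1 - 1 / p) *
      (((t - x) powr (r * p + 1) + (y - t) powr (r * p + 1)) / (r * p + 1)) powr (1 / p))"
    if A: "a \<le> x" "x \<le> t" "t \<le> y" "y \<le> b" for x t y
  proof -
    \<comment> \<open>Increments of \<open>g\<close> represent the integral of
      \<open>f - f t\<close> against \<open>u\<close>. Replacing \<open>f\<close> by its value at
      the tag splits an increment into the local error of \<open>G\<close> and a product bounded by
      the Hoelder and Lipschitz conditions.\<close>
    define g where "g z = G z - f t * u z" for z
    have "\<bar>g d - g c\<bar> \<le> H * L * \<bar>s - t\<bar> powr r * (d - c) + 5 * H * L * (d - c) powr r * (d - c)"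
      if B: "x \<le> c" "c \<le> s" "s \<le> d" "d \<le> y" for c s d
    proof -
      have "\<bar>f s - f t\<bar> \<le> H * \<bar>s - t\<bar> powr r"
        using f A B by (simp add: holder_on_def)
      moreover have "\<bar>u d - u c\<bar> \<le> L * (d - c)"
        using lipschitz_onD[OF u, of d c] A B by (simp add: dist_real_def)
      ultimately have "\<bar>(f s - f t) * (u d - u c)\<bar> \<le> (H * \<bar>s - t\<bar> powr r) * (L * (d - c))"
        unfolding abs_mult using \<open>H > 0\<close> by (intro mult_mono) auto
      moreover have "\<bar>G d - G c - f s * (u d - u c)\<bar> \<le> 5 * H * L * (d - c) powr r * (d - c)"
        using G A B by auto
      moreover have "g d - g c = (G d - G c - f s * (u d - u c)) + (f s - f t) * (u d - u c)"
        by (simp add: g_def algebra_simps)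
      ultimately show ?thesis
        by (simp add: mult_ac)
    qed
    then have "\<bar>g y - g x\<bar> \<le> H * L * (((t - x) powr (r + 1) + (y - t) powr (r + 1)) / (r + 1))"
      using A \<open>H > 0\<close> \<open>L > 0\<close> \<open>0 < r\<close> by (intro increment_bound[where C = "5 * H * L"]) auto
    also have "\<dots> \<le> H * L * ((y - x) powr (1 - 1 / p) *
        (((t - x) powr (r * p + 1) + (y - t) powr (r * p + 1)) / (r * p + 1)) powr (1 / p))"
      using Hoelder_powr_integral[OF \<open>1 < p\<close> \<open>0 < r\<close>, of "t - x" "y - t"] A \<open>H > 0\<close> \<open>L > 0\<close>
      by (intro mult_left_mono) auto
    finally show ?thesis
      by (simp add: g_def algebra_simps)
  qed
  show ?thesis
  proof (intro conjI allI impI)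
    show "rs_integrable a b f u"
      using int by (auto simp: rs_integrable_def)
    fix t0 x t1
    assume A: "a \<le> t0 \<and> t0 \<le> x \<and> x \<le> t1 \<and> t1 \<le> b"
    \<comment> \<open>Additivity at \<open>x\<close>: the increment \<open>G b - G a\<close> splits
      there, and each part takes its own node value.\<close>
    have "remainder a b f u t0 x t1 =
        (G x - G a - f t0 * (u x - u a)) + (G b - G x - f t1 * (u b - u x))"
      by (simp add: remainder_def int_eq algebra_simps)
    then show "\<bar>remainder a b f u t0 x t1\<bar> \<le> H * L *
          ((x - a) powr (1 - 1 / p) *
             (((t0 - a) powr (r * p + 1) + (x - t0) powr (r * p + 1)) / (r * p + 1)) powr (1 / p)
         + (b - x) powr (1 - 1 / p) *
             (((t1 - x) powr (r * p + 1) + (b - t1) powr (r * p + 1)) / (r * p + 1)) powr (1 / p))"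
      using piece[of a t0 x] piece[of x t1 b] A by (simp add: distrib_left)
  qed
qed

end
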